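(* Let $m\ge 2$, let $u=[u_1,\dots,u_m]^T\in\mathbb{C}^m$ with $u_1,\dots,u_m\neq 0$, and let $C(u,\pi_1)=\sum_{r=0}^{k}c_rP(u,\pi_1)^r$ (with $k\in\mathbb{N}$ and $c_0,\dots,c_k\in\mathbb{C}$) be a generalized circulant matrix of order $m$ corresponding to $P(u,\pi_1)$. Let $\lambda=\sqrt[m]{\prod_{i=1}^m u_i}$, let $$\Lambda_1=\mathrm{diag}\left(\frac{\lambda}{u_m},\frac{\lambda^2}{u_1u_m},\dots,\frac{\lambda^{m-1}}{u_1u_2\cdots u_{m-2}u_m},1\right),$$ and let $F=(\omega^{i(j-1)})_{1\le i,j\le m}$ be the discrete Fourier transform matrix, where $\omega=\exp\left(\frac{2\pi \mathrm{i}}{m}\right)$. Then the columns of the matrix $\Lambda_1F$ form a basis (of $\mathbb{C}^m$) of eigenvectors of $C(u,\pi_1)$.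
   Context: For $s\in\{0,1,\dots,m-1\}$, $\pi_s$ is the permutation $\pi_s(x)=(x+s)\ (\mathrm{mod}\ m)$ of the indices modulo $m$; row and column indices of $m\times m$ matrices are taken in $\{1,\dots,m\}$, with residue $0$ identified with $m$. The permutation matrix $P_{\pi}=(p_{i,j})$ has $p_{i,j}=1$ if $j=\pi(i)$ and $0$ otherwise. For $u\in\mathbb{C}^m$, $P(u,\pi_s)=D_uP_{\pi_s}$ with $D_u=\mathrm{diag}(u_1,\dots,u_m)$; thus the only nonzero entry of row $i$ of $P(u,\pi_s)$ is $u_i$, in column $\pi_s(i)$. A generalized circulant matrix corresponding to $P(u,\pi_s)$ is a matrix $C(u,\pi_s)=\sum_{r=0}^{k}c_rP(u,\pi_s)^r$ with $k\in\mathbb{N}$ and $c_r\in\mathbb{C}$. The symbol $\sqrt[m]{z}$ denotes a fixed complex $m$-th root of $z$. The imaginary unit is $\mathrm{i}$. For $m=2$, $\Lambda_1=\mathrm{diag}(\lambda/u_2,1)$. *)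

theory Defs
  imports Complex_Main "Jordan_Normal_Form.Char_Poly" "Jordan_Normal_Form.VS_Connect"
begin

text \<open>
  Vectors and matrices of the library are indexed from 0, whereas the mathematics uses the indices
  1, ..., m. All formulas below are written with the indices 1, ..., m; the next two definitions
  are the only places where the shift is made.
\<close>

definition vec_entry :: "'a vec \<Rightarrow> nat \<Rightarrow> 'a" where
  "vec_entry u i = vec_index u (i - 1)"

definition sq_mat :: "nat \<Rightarrow> (nat \<Rightarrow> nat \<Rightarrow> 'a) \<Rightarrow> 'a mat" where
  "sq_mat m f = Matrix.mat m m (\<lambda>(i, j). f (i + 1) (j + 1))"

definition diag_matrix :: "nat \<Rightarrow> (nat \<Rightarrow> 'a::zero) \<Rightarrow> 'a mat" where
  "diag_matrix m d = sq_mat m (\<lambda>i j. if i = j then d i else 0)"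

text \<open>The representative of the residue 0 is m, so that the shift maps {1, ..., m} to itself.\<close>

definition cyclic_shift :: "nat \<Rightarrow> nat \<Rightarrow> nat \<Rightarrow> nat" where
  "cyclic_shift m s x = (if (x + s) mod m = 0 then m else (x + s) mod m)"

definition perm_mat :: "nat \<Rightarrow> (nat \<Rightarrow> nat) \<Rightarrow> complex mat" where
  "perm_mat m p = sq_mat m (\<lambda>i j. if j = p i then 1 else 0)"

definition gen_perm_mat :: "nat \<Rightarrow> complex vec \<Rightarrow> (nat \<Rightarrow> nat) \<Rightarrow> complex mat" where
  "gen_perm_mat m u p = diag_matrix m (vec_entry u) * perm_mat m p"

text \<open>
  The type of matrices carries no additive monoid structure of its own, so the sum of m by m
  matrices is the finite sum in the additive group of the library's matrix module.
\<close>

definition gen_circulant ::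
    "nat \<Rightarrow> complex vec \<Rightarrow> (nat \<Rightarrow> nat) \<Rightarrow> nat \<Rightarrow> (nat \<Rightarrow> complex) \<Rightarrow> complex mat" where
  "gen_circulant m u p k c =
     finsum (module_mat TYPE(complex) m m)
       (\<lambda>r. smult_mat (c r) (pow_mat (gen_perm_mat m u p) r)) {0..k}"

definition Lambda1 :: "nat \<Rightarrow> complex vec \<Rightarrow> complex \<Rightarrow> complex mat" where
  "Lambda1 m u l =
     diag_matrix m (\<lambda>i. if i = m then 1 else l ^ i / ((\<Prod>q\<in>{1..<i}. vec_entry u q) * vec_entry u m))"

definition dft_mat :: "nat \<Rightarrow> complex mat" where
  "dft_mat m = sq_mat m (\<lambda>i j. exp (2 * complex_of_real pi * \<i> / of_nat m) ^ (i * (j - 1)))"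

text \<open>
  The family of columns of B, and not merely the set of its columns, is a basis of complex m-space
  (hence the distinctness), and every column is an eigenvector of A.
\<close>

definition cols_eigenbasis :: "nat \<Rightarrow> complex mat \<Rightarrow> complex mat \<Rightarrow> bool" where
  "cols_eigenbasis m A B \<longleftrightarrow>
     distinct (cols B) \<and>
     vectorspace.basis class_ring (module_vec TYPE(complex) m) (set (cols B)) \<and>
     (\<forall>v \<in> set (cols B). \<exists>z. eigenvector A v z)"

end

theory Submission
  imports Defs "Jordan_Normal_Form.DL_Rank"
begin

text \<open>
  Let P be the weighted cyclic shift, so that (P v)_i = u_i v_(i+1) with the index read cyclically,
  and let w be any m-th root of unity. Try v_i = d_i w^i. Moving the index by one step contributes
  a factor w even across the wrap-around, because w^m = 1; hence v is an eigenvector for l w as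
  soon as the weights satisfy u_i d_(i+1) = l d_i cyclically. This recursion has the solution
  d_i = l^i / (u_1 ... u_(i-1) u_m), and it closes up because l^m = u_1 ... u_m forces d_m = 1.
  These d_i are precisely the diagonal entries of the matrix \<Lambda>_1, and the j-th column of
  \<Lambda>_1 F is the vector v belonging to w = \<omega>^(j-1). An eigenvector of P is one of
  every polynomial in P, hence of the generalized circulant matrix
  (\<open>eigenvector_shift_mat\<close>, \<open>eigenvector_gen_circulant\<close>).

  That the columns form a basis is the nonvanishing of det(\<Lambda>_1 F)
  (\<open>nonsingular_cols_basis\<close>). The diagonal factor is invertible since l and all u_i are
  nonzero, and F is invertible by the orthogonality of the characters of the cyclic group: its
  conjugate transpose, divided by m, is its inverse (\<open>dft_mat_right_inverse\<close>).
\<close>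

section \<open>Diagonal and weighted permutation matrices\<close>

lemma sq_mat_carrier [simp]: "sq_mat m f \<in> carrier_mat m m"
  by (simp add: sq_mat_def)

lemma diag_matrix_carrier [simp]: "diag_matrix m d \<in> carrier_mat m m"
  by (simp add: diag_matrix_def)

lemma gen_perm_mat_carrier: "gen_perm_mat m u p \<in> carrier_mat m m"
  unfolding gen_perm_mat_def perm_mat_def by (rule mult_carrier_mat[of _ m m]) simp_all

lemma sq_mat_mult:
  fixes f g :: "nat \<Rightarrow> nat \<Rightarrow> 'a::semiring_0"
  shows "sq_mat m f * sq_mat m g = sq_mat m (\<lambda>i j. \<Sum>q\<in>{1..m}. f i q * g q j)"
  by (rule eq_matI)
    (auto simp: sq_mat_def scalar_prod_def
      intro!: sum.reindex_bij_witness[of _ "\<lambda>q. q - 1" Suc])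

lemma diag_matrix_mult:
  fixes d :: "nat \<Rightarrow> 'a::semiring_0"
  shows "diag_matrix m d * sq_mat m f = sq_mat m (\<lambda>i j. d i * f i j)"
  unfolding diag_matrix_def sq_mat_mult
  by (rule eq_matI) (auto simp: sq_mat_def if_distrib[of "\<lambda>x. x * _"] cong: if_cong)

lemma gen_perm_mat_eq:
  "gen_perm_mat m u p = sq_mat m (\<lambda>i j. if j = p i then vec_entry u i else 0)"
  unfolding gen_perm_mat_def perm_mat_def diag_matrix_mult
  by (rule eq_matI) (auto simp: sq_mat_def)

lemma gen_perm_mat_mult_vec:
  assumes "\<And>i. i \<in> {1..m} \<Longrightarrow> p i \<in> {1..m}"
  shows "gen_perm_mat m u p *\<^sub>v vec m (\<lambda>i. f (i + 1)) = vec m (\<lambda>i. vec_entry u (i + 1) * f (p (i + 1)))"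
proof (rule eq_vecI)
  fix i assume "i < dim_vec (vec m (\<lambda>i. vec_entry u (i + 1) * f (p (i + 1))))"
  then have i: "i < m" by simp
  then have pi: "p (i + 1) \<in> {1..m}" using assms[of "i + 1"] by auto
  have "(gen_perm_mat m u p *\<^sub>v vec m (\<lambda>i. f (i + 1))) $ i
      = (\<Sum>j<m. if j = p (i + 1) - 1 then vec_entry u (i + 1) * f (p (i + 1)) else 0)"
    unfolding gen_perm_mat_eq using i pi
    by (auto simp: sq_mat_def scalar_prod_def lessThan_atLeast0
        simp del: sum.delta sum.delta' intro!: sum.cong)
  also have "\<dots> = vec_entry u (i + 1) * f (p (i + 1))"
    using pi by (auto simp: sum.delta)
  finally show "(gen_perm_mat m u p *\<^sub>v vec m (\<lambda>i. f (i + 1))) $ i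
      = vec m (\<lambda>i. vec_entry u (i + 1) * f (p (i + 1))) $ i"
    using i by simp
qed (simp add: gen_perm_mat_eq sq_mat_def)

section \<open>Polynomials in a matrix\<close>

text \<open>
  Membership in the carrier is proved together with the equation because the distributive law in
  the induction step requires it of the partial sums.
\<close>

lemma finsum_mat_mult_eigenvector:
  fixes A :: "'b \<Rightarrow> 'a :: comm_ring_1 mat"
  assumes "finite I" and "v \<in> carrier_vec n"
    and "\<And>r. r \<in> I \<Longrightarrow> A r \<in> carrier_mat n n"
    and "\<And>r. r \<in> I \<Longrightarrow> A r *\<^sub>v v = z r \<cdot>\<^sub>v v"
  shows "finsum (module_mat TYPE('a) n n) A I \<in> carrier_mat n n
    \<and> finsum (module_mat TYPE('a) n n) A I *\<^sub>v v = (\<Sum>r\<in>I. z r) \<cdot>\<^sub>v v"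
  using assms
proof (induction I rule: finite_induct)
  case empty
  interpret abelian_group "module_mat TYPE('a) n n" by (rule abelian_group_mat)
  show ?case using empty by (auto simp: module_mat_simps)
next
  case (insert r I)
  interpret abelian_group "module_mat TYPE('a) n n" by (rule abelian_group_mat)
  have eq: "finsum (module_mat TYPE('a) n n) A (insert r I)
      = A r + finsum (module_mat TYPE('a) n n) A I"
    using insert by (subst finsum_insert) (auto simp: module_mat_simps)
  show ?case
    unfolding eq using insert
    by (auto simp: add_mult_distrib_mat_vec[where nr = n and nc = n] add_smult_distrib_vec)
qed

lemma smult_mat_mult_vec:
  fixes A :: "'a :: comm_ring_1 mat"
  assumes "A \<in> carrier_mat nr nc" and "v \<in> carrier_vec nc"
  shows "(a \<cdot>\<^sub>m A) *\<^sub>v v = a \<cdot>\<^sub>v (A *\<^sub>v v)"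
  using assms by (intro eq_vecI) (auto simp: scalar_prod_def sum_distrib_left mult.assoc)

lemma eigenvector_gen_circulant:
  assumes ev: "eigenvector (gen_perm_mat m u p) v z"
  shows "eigenvector (gen_circulant m u p k c) v (\<Sum>r\<in>{0..k}. c r * z ^ r)"
proof -
  note P = gen_perm_mat_carrier[of m u p]
  have v: "v \<in> carrier_vec m" "v \<noteq> 0\<^sub>v m"
    using ev P by (auto simp: eigenvector_def)
  have "gen_circulant m u p k c \<in> carrier_mat m m
    \<and> gen_circulant m u p k c *\<^sub>v v = (\<Sum>r\<in>{0..k}. c r * z ^ r) \<cdot>\<^sub>v v"
    unfolding gen_circulant_def
  proof (rule finsum_mat_mult_eigenvector)
    fix r
    show "c r \<cdot>\<^sub>m gen_perm_mat m u p ^\<^sub>m r \<in> carrier_mat m m"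
      using P by simp
    show "(c r \<cdot>\<^sub>m gen_perm_mat m u p ^\<^sub>m r) *\<^sub>v v = (c r * z ^ r) \<cdot>\<^sub>v v"
      using P v eigenvector_pow[OF P ev, of r]
      by (simp add: smult_mat_mult_vec[where nr = m and nc = m] smult_smult_assoc)
  qed (use v in auto)
  then show ?thesis using v by (auto simp: eigenvector_def)
qed

section \<open>The eigenvector equation\<close>

lemma cyclic_shift_one:
  assumes "i \<in> {1..m}"
  shows "cyclic_shift m 1 i = (if i = m then 1 else i + 1)"
proof (cases "i = m")
  case True
  then show ?thesis using assms by (cases "m = 1") (auto simp: cyclic_shift_def mod_Suc)
next
  case False
  then show ?thesis using assms by (cases "i + 1 = m") (auto simp: cyclic_shift_def)
qed

text \<open>
  The last diagonal entry of \<Lambda>_1 is set to 1 separately, but the formula for the other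
  entries gives the same value there if l^m is the product of the nonzero weights. Using it for
  all indices makes the recursion below uniform.
\<close>

definition Lambda1_entry :: "nat \<Rightarrow> complex vec \<Rightarrow> complex \<Rightarrow> nat \<Rightarrow> complex" where
  "Lambda1_entry m u l i = l ^ i / ((\<Prod>q\<in>{1..<i}. vec_entry u q) * vec_entry u m)"

lemma Lambda1_entry_last:
  assumes "m \<ge> 1" and "\<forall>i\<in>{1..m}. vec_entry u i \<noteq> 0"
    and "l ^ m = (\<Prod>i\<in>{1..m}. vec_entry u i)"
  shows "Lambda1_entry m u l m = 1"
proof -
  have "{1..m} = insert m {1..<m}" using assms(1) by auto
  then have "l ^ m = (\<Prod>q\<in>{1..<m}. vec_entry u q) * vec_entry u m"
    using assms(3) by simp
  moreover have "l ^ m \<noteq> 0" using assms(2,3) by simp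
  ultimately show ?thesis by (simp add: Lambda1_entry_def)
qed

lemma Lambda1_eq:
  assumes "m \<ge> 1" and "\<forall>i\<in>{1..m}. vec_entry u i \<noteq> 0"
    and "l ^ m = (\<Prod>i\<in>{1..m}. vec_entry u i)"
  shows "Lambda1 m u l = diag_matrix m (Lambda1_entry m u l)"
proof -
  have "(\<lambda>i. if i = m then 1
      else l ^ i / ((\<Prod>q\<in>{1..<i}. vec_entry u q) * vec_entry u m)) = Lambda1_entry m u l"
    using Lambda1_entry_last[OF assms] by (auto simp: Lambda1_entry_def)
  then show ?thesis by (simp add: Lambda1_def)
qed

text \<open>
  This is where the diagonal scaling comes from: conjugating by it turns the weights u_i into the
  constant weight l. At i = m the recursion wraps around and uses d_m = 1.
\<close>

lemma Lambda1_entry_shift: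
  assumes "m \<ge> 1" and "\<forall>i\<in>{1..m}. vec_entry u i \<noteq> 0"
    and "l ^ m = (\<Prod>i\<in>{1..m}. vec_entry u i)" and "i \<in> {1..m}"
  shows "vec_entry u i * Lambda1_entry m u l (cyclic_shift m 1 i) = l * Lambda1_entry m u l i"
proof (cases "i = m")
  case True
  have "vec_entry u m \<noteq> 0" using assms(1,2) by simp
  moreover have "cyclic_shift m 1 i = 1"
    unfolding cyclic_shift_one[OF assms(4)] using True by simp
  ultimately show ?thesis
    unfolding True Lambda1_entry_last[OF assms(1-3)]
    by (simp add: Lambda1_entry_def)
next
  case False
  have "{1..<i + 1} = insert i {1..<i}" using assms(4) by auto
  then have "(\<Prod>q\<in>{1..<i + 1}. vec_entry u q) = vec_entry u i * (\<Prod>q\<in>{1..<i}. vec_entry u q)"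
    by simp
  moreover have "vec_entry u i \<noteq> 0" using assms by auto
  ultimately show ?thesis
    unfolding cyclic_shift_one[OF assms(4)] using False by (simp add: Lambda1_entry_def)
qed

lemma power_cyclic_shift:
  fixes w :: complex
  assumes "w ^ m = 1" and "i \<in> {1..m}"
  shows "w ^ cyclic_shift m 1 i = w * w ^ i"
  unfolding cyclic_shift_one[OF assms(2)] using assms(1) by auto

lemma eigenvector_shift_mat:
  assumes "m \<ge> 1" and "\<forall>i\<in>{1..m}. vec_entry u i \<noteq> 0"
    and "l ^ m = (\<Prod>i\<in>{1..m}. vec_entry u i)" and "w ^ m = 1"
  shows "eigenvector (gen_perm_mat m u (cyclic_shift m 1))
    (vec m (\<lambda>i. Lambda1_entry m u l (i + 1) * w ^ (i + 1))) (l * w)"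
proof -
  let ?f = "\<lambda>i. Lambda1_entry m u l i * w ^ i"
  let ?P = "gen_perm_mat m u (cyclic_shift m 1)"
  have shift: "cyclic_shift m 1 i \<in> {1..m}" if "i \<in> {1..m}" for i
    using that unfolding cyclic_shift_one[OF that] by auto
  have "?P *\<^sub>v vec m (\<lambda>i. ?f (i + 1))
      = vec m (\<lambda>i. vec_entry u (i + 1) * ?f (cyclic_shift m 1 (i + 1)))"
    by (rule gen_perm_mat_mult_vec[OF shift])
  also have "\<dots> = (l * w) \<cdot>\<^sub>v vec m (\<lambda>i. ?f (i + 1))"
  proof (rule eq_vecI)
    fix i assume "i < dim_vec ((l * w) \<cdot>\<^sub>v vec m (\<lambda>i. ?f (i + 1)))"
    then have i: "i < m" "i + 1 \<in> {1..m}" by auto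
    have "vec_entry u (i + 1) * ?f (cyclic_shift m 1 (i + 1))
        = (l * Lambda1_entry m u l (i + 1)) * (w * w ^ (i + 1))"
      using Lambda1_entry_shift[OF assms(1-3) i(2)] power_cyclic_shift[OF assms(4) i(2)]
      by (metis mult.assoc)
    then show "vec m (\<lambda>i. vec_entry u (i + 1) * ?f (cyclic_shift m 1 (i + 1))) $ i
        = ((l * w) \<cdot>\<^sub>v vec m (\<lambda>i. ?f (i + 1))) $ i"
      using i(1) by (simp add: mult_ac)
  qed simp
  finally have "?P *\<^sub>v vec m (\<lambda>i. ?f (i + 1)) = (l * w) \<cdot>\<^sub>v vec m (\<lambda>i. ?f (i + 1))" .
  \<comment> \<open>The last entry is 1 * w^m = 1, so the vector does not vanish.\<close>
  moreover have "vec m (\<lambda>i. ?f (i + 1)) \<noteq> 0\<^sub>v m"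
  proof
    assume "vec m (\<lambda>i. ?f (i + 1)) = 0\<^sub>v m"
    then have "vec m (\<lambda>i. ?f (i + 1)) $ (m - 1) = 0\<^sub>v m $ (m - 1)" by simp
    then have "w = 0"
      using assms(1) Lambda1_entry_last[OF assms(1-3)] by auto
    then show False using assms(1,4) by (simp add: zero_power)
  qed
  ultimately show ?thesis
    by (simp add: eigenvector_def gen_perm_mat_eq sq_mat_def)
qed

section \<open>Columns of a nonsingular matrix\<close>

lemma nonsingular_cols_basis:
  fixes B :: "'a :: field mat"
  assumes B: "B \<in> carrier_mat n n" and det: "det B \<noteq> 0"
  shows "distinct (cols B)"
    and "vectorspace.basis class_ring (module_vec TYPE('a) n) (set (cols B))"
proof -
  interpret vec_space "TYPE('a)" n .
  have rank: "rank B = n" using det_rank_iff[OF B] det by simp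
  show dist: "distinct (cols B)"
    using non_distinct_low_rank[OF B] rank by auto
  show "basis (set (cols B))"
  proof (rule dim_li_is_basis)
    show "lin_indpt (set (cols B))"
      by (rule full_rank_lin_indpt[OF B rank dist])
    show "card (set (cols B)) \<ge> dim"
      using B by (simp add: distinct_card[OF dist] dim_is_n)
  qed (use B cols_dim[of B] in \<open>auto\<close>)
qed

lemma det_nonzero_if_right_inverse:
  fixes A B :: "'a :: field mat"
  assumes "A \<in> carrier_mat n n" and "B \<in> carrier_mat n n" and "A * B = 1\<^sub>m n"
  shows "det A \<noteq> 0"
  using det_mult[OF assms(1,2)] assms(3) by auto

lemma det_diag_matrix_nonzero:
  fixes d :: "nat \<Rightarrow> 'a::field"
  assumes "\<And>i. i \<in> {1..m} \<Longrightarrow> d i \<noteq> 0"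
  shows "det (diag_matrix m d) \<noteq> 0"
proof (rule det_nonzero_if_right_inverse)
  show "diag_matrix m d * diag_matrix m (\<lambda>i. inverse (d i)) = 1\<^sub>m m"
    unfolding diag_matrix_def[of m "\<lambda>i. inverse (d i)"] diag_matrix_mult
    using assms by (intro eq_matI) (auto simp: sq_mat_def)
qed simp_all

section \<open>The discrete Fourier transform\<close>

abbreviation unity_root :: "nat \<Rightarrow> complex" where
  "unity_root m \<equiv> exp (2 * complex_of_real pi * \<i> / of_nat m)"

lemma unity_root_power: "unity_root m ^ k = cis (2 * pi * real k / real m)"
  by (simp add: exp_of_nat_mult[symmetric] cis_conv_exp mult_ac)

lemma unity_root_power_order:
  assumes "m \<ge> 1"
  shows "unity_root m ^ m = 1"
  using assms by (simp add: unity_root_power)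

lemma unity_root_inj:
  assumes "m \<ge> 1" and "i \<in> {1..m}" and "j \<in> {1..m}" and "unity_root m ^ i = unity_root m ^ j"
  shows "i = j"
proof -
  have "unity_root m ^ i = unity_root m * unity_root m ^ (i - 1)"
    "unity_root m ^ j = unity_root m * unity_root m ^ (j - 1)"
    using assms(2,3) by (simp_all add: power_eq_if[of _ i] power_eq_if[of _ j])
  then have "unity_root m ^ (i - 1) = unity_root m ^ (j - 1)"
    using assms(4) by simp
  moreover have "inj_on (\<lambda>k. unity_root m ^ k) {..<m}"
    using bij_betw_roots_unity[of m] assms(1) by (simp add: unity_root_power bij_betw_def)
  ultimately have "i - 1 = j - 1"
    using assms(2,3) by (auto dest!: inj_onD)
  then show ?thesis using assms(2,3) by auto
qed

text \<open>
  An off-diagonal entry of the product is a sum of the powers of a ratio q of two distinct powers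
  of \<omega>; it vanishes as a geometric sum because q^m = 1 and q \<noteq> 1.
\<close>

lemma dft_mat_right_inverse:
  assumes "m \<ge> 1"
  shows "dft_mat m * sq_mat m (\<lambda>i j. inverse (of_nat m * unity_root m ^ (j * (i - 1)))) = 1\<^sub>m m"
proof (rule eq_matI)
  fix a b assume "a < dim_row (1\<^sub>m m)" "b < dim_col (1\<^sub>m m)"
  then have ab: "a < m" "b < m" by auto
  let ?w = "unity_root m"
  let ?q = "?w ^ (a + 1) / ?w ^ (b + 1)"
  have "(dft_mat m * sq_mat m (\<lambda>i j. inverse (of_nat m * ?w ^ (j * (i - 1))))) $$ (a, b)
      = (\<Sum>j\<in>{1..m}. ?w ^ ((a + 1) * (j - 1)) * inverse (of_nat m * ?w ^ ((b + 1) * (j - 1))))"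
    unfolding dft_mat_def sq_mat_mult using ab by (simp add: sq_mat_def)
  also have "\<dots> = (\<Sum>j\<in>{1..m}. ?q ^ (j - 1) / of_nat m)"
    by (simp only: power_mult power_divide) (simp add: divide_inverse mult_ac)
  also have "\<dots> = (\<Sum>j<m. ?q ^ j / of_nat m)"
    by (rule sum.reindex_bij_witness[of _ Suc "\<lambda>j. j - 1"]) auto
  also have "\<dots> = (\<Sum>j<m. ?q ^ j) / of_nat m"
    by (simp add: sum_divide_distrib)
  also have "\<dots> = (if a = b then 1 else 0)"
  proof (cases "a = b")
    case True
    then show ?thesis using assms by simp
  next
    case False
    have "?q \<noteq> 1"
      using unity_root_inj[OF assms, of "a + 1" "b + 1"] ab False by auto
    moreover have "?q ^ m = 1"
    proof -
      have "(?w ^ k) ^ m = 1" for k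
        by (metis unity_root_power_order[OF assms] mult.commute power_mult power_one)
      then show ?thesis by (simp only: power_divide div_by_1)
    qed
    ultimately show ?thesis using False geometric_sum[of ?q m] by simp
  qed
  finally show "(dft_mat m * sq_mat m (\<lambda>i j. inverse (of_nat m * ?w ^ (j * (i - 1))))) $$ (a, b)
      = 1\<^sub>m m $$ (a, b)"
    using ab by simp
qed (simp_all add: dft_mat_def sq_mat_def)

section \<open>The eigenvector basis\<close>

theorem proposition2p1:
  fixes m k :: nat and u :: "complex vec" and c :: "nat \<Rightarrow> complex" and l :: complex
  assumes "m \<ge> 2"
    and "u \<in> carrier_vec m"
    and "\<forall>i\<in>{1..m}. vec_entry u i \<noteq> 0"
    and "l ^ m = (\<Prod>i\<in>{1..m}. vec_entry u i)"
  shows "cols_eigenbasis m (gen_circulant m u (cyclic_shift m 1) k c) (Lambda1 m u l * dft_mat m)"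
proof -
  let ?B = "Lambda1 m u l * dft_mat m" and ?d = "Lambda1_entry m u l" and ?w = "unity_root m"
  have m: "m \<ge> 1" using assms(1) by simp
  note Lambda = Lambda1_eq[OF m assms(3,4)]
  have F: "dft_mat m \<in> carrier_mat m m" by (simp add: dft_mat_def)
  have B: "?B \<in> carrier_mat m m"
    unfolding Lambda by (rule mult_carrier_mat[OF diag_matrix_carrier F])

  have "l \<noteq> 0" using assms(3,4) m by (auto simp: zero_power)
  then have "?d i \<noteq> 0" if "i \<in> {1..m}" for i
    using assms(3) that by (auto simp: Lambda1_entry_def)
  then have "det (Lambda1 m u l) \<noteq> 0"
    unfolding Lambda by (rule det_diag_matrix_nonzero)
  moreover have "det (dft_mat m) \<noteq> 0"
    using det_nonzero_if_right_inverse[OF F _ dft_mat_right_inverse[OF m]] by simp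
  ultimately have det: "det ?B \<noteq> 0"
    using det_mult[of "Lambda1 m u l" m "dft_mat m"] F by (simp add: Lambda)

  have "\<exists>z. eigenvector (gen_circulant m u (cyclic_shift m 1) k c) v z" if v: "v \<in> set (cols ?B)" for v
  proof -
    obtain j where j: "j < m" "v = col ?B j"
      using v F by (auto simp: cols_def)
    \<comment> \<open>The columns are counted from 0 here, so column j belongs to the root of unity
      \<omega>^j.\<close>
    have "v = vec m (\<lambda>i. ?d (i + 1) * (?w ^ j) ^ (i + 1))"
      unfolding j(2) Lambda dft_mat_def diag_matrix_mult
      using j(1) by (intro eq_vecI) (auto simp: sq_mat_def power_mult[symmetric] power_add mult.commute)
    moreover have "(?w ^ j) ^ m = 1"
      by (metis unity_root_power_order[OF m] mult.commute power_mult power_one)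
    ultimately have "eigenvector (gen_perm_mat m u (cyclic_shift m 1)) v (l * ?w ^ j)"
      using eigenvector_shift_mat[OF m assms(3,4)] by simp
    then show ?thesis
      by (blast intro: eigenvector_gen_circulant)
  qed
  then show ?thesis
    unfolding cols_eigenbasis_def using nonsingular_cols_basis[OF B det] by blast
qed

end
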